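(* (a) (Deterministic stratified case.) Let $(p_n)_{n\ge1}$ be a deterministic sequence in $[0,1]$, and let $g_n$ be the empirical distribution of the break points of the split-merge dynamics with splitting proportions $p_{n,k}=p_n$ for all $1\le k\le n$. Assume that the averages $\frac1n\sum_{k=1}^n p_k$ converge to some limit $\bar p$ as $n\to\infty$. Then, as $n\to\infty$, $$g_n\Rightarrow \bar p\,\delta_0+(1-\bar p)\,\delta_1\quad\text{weakly on }[0,1].$$ (b) (Random stratified and fully random cases.) Suppose that either (i) (random stratified case) $(P_n)_{n\ge1}$ are i.i.d. random variables in $[0,1]$, and $P_{n,k}=P_n$ for all $1\le k\le n$; put $\bar p=\mathbb{E}(P_1)$; or (ii) (fully random case) $(P_{n,k}:n\ge1,\ 1\le k\le n)$ is an array of i.i.d. random variables in $[0,1]$; put $\bar p=\mathbb{E}(P_{1,1})$. Let $G_n$ be the (random) empirical distribution of the break points of the split-merge dynamics with splitting proportions $(P_{n,k})$. Then, almost surely, as $n\to\infty$, $$G_n\Rightarrow \bar p\,\delta_0+(1-\bar p)\,\delta_1\quad\text{weakly on }[0,1].$$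
   Context: Given splitting proportions $(p_{n,k}:n\ge1,\ 1\le k\le n)$ in $[0,1]$, the break points of the split-merge dynamics are defined by $a_{n,0}=0$, $a_{n,n+1}=1$ for all $n\ge0$, and recursively for $n\ge1$, $$a_{n,k}=p_{n,k}\,a_{n-1,k-1}+(1-p_{n,k})\,a_{n-1,k},\qquad k=1,\dots,n.$$ When the proportions are random, they are written $P_{n,k}$ and the break points, defined by the same recursion and boundary values, are written $A_{n,k}$. The empirical distributions of the break points are, for $n\ge1$, $$g_n=\frac1n\sum_{k=1}^n\delta_{a_{n,k}},\qquad G_n=\frac1n\sum_{k=1}^n\delta_{A_{n,k}},$$ where $\delta_a$ is the unit mass at $a$. *)

theory Defs
  imports "HOL-Probability.Probability"
begin

text \<open>
  The recursion only consults \<open>p n k\<close> for \<open>1 \<le> k \<le> n\<close>; the break points are meant for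
  \<open>0 \<le> k \<le> n + 1\<close> (the value at \<open>k > n + 1\<close> is a dummy).
\<close>

primrec break_point :: "(nat \<Rightarrow> nat \<Rightarrow> real) \<Rightarrow> nat \<Rightarrow> nat \<Rightarrow> real" where
  "break_point p 0 k = (if k = 0 then 0 else 1)"
| "break_point p (Suc n) k =
     (if k = 0 then 0
      else if k > Suc n then 1
      else p (Suc n) k * break_point p n (k - 1) + (1 - p (Suc n) k) * break_point p n k)"

text \<open>
  \<open>\<Sum>i\<in>I. w i * \<delta>\<^bsub>x i\<^esub>\<close> for a finite set \<open>I\<close> and nonnegative weights, as a Borel measure on
  the real line; coinciding points accumulate their weights.
\<close>

definition point_masses :: "'i set \<Rightarrow> ('i \<Rightarrow> real) \<Rightarrow> ('i \<Rightarrow> real) \<Rightarrow> real measure" where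
  "point_masses I w x =
     measure_of UNIV (sets borel) (\<lambda>B. \<Sum>i\<in>I. ennreal (w i) * emeasure (return borel (x i)) B)"

lemma space_point_masses [simp]: "space (point_masses I w x) = UNIV"
  by (simp add: point_masses_def)

lemma sets_point_masses [simp, measurable_cong]: "sets (point_masses I w x) = sets borel"
  using sets.sigma_sets_eq[of "borel :: real measure"] by (simp add: point_masses_def)

lemma emeasure_point_masses:
  assumes B: "B \<in> sets borel"
  shows "emeasure (point_masses I w x) B =
           (\<Sum>i\<in>I. ennreal (w i) * emeasure (return borel (x i)) B)"
proof (rule emeasure_measure_of[OF point_masses_def])
  show "countably_additive (sets (point_masses I w x))
          (\<lambda>B. \<Sum>i\<in>I. ennreal (w i) * emeasure (return borel (x i)) B)"
  proof (rule countably_additiveI)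
    fix A :: "nat \<Rightarrow> real set"
    assume A: "range A \<subseteq> sets (point_masses I w x)" "disjoint_family A"
    have "(\<Sum>j. \<Sum>i\<in>I. ennreal (w i) * emeasure (return borel (x i)) (A j)) =
            (\<Sum>i\<in>I. \<Sum>j. ennreal (w i) * emeasure (return borel (x i)) (A j))"
      by (intro suminf_sum) auto
    also have "\<dots> = (\<Sum>i\<in>I. ennreal (w i) * emeasure (return borel (x i)) (\<Union>j. A j))"
      using A by (simp add: suminf_emeasure del: emeasure_return)
    finally show "(\<Sum>j. \<Sum>i\<in>I. ennreal (w i) * emeasure (return borel (x i)) (A j)) =
        (\<Sum>i\<in>I. ennreal (w i) * emeasure (return borel (x i)) (\<Union>j. A j))" .
  qed
qed (use B in \<open>auto simp: positive_def\<close>)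

lemma real_distribution_point_masses:
  assumes "\<And>i. i \<in> I \<Longrightarrow> 0 \<le> w i" "sum w I = 1"
  shows "real_distribution (point_masses I w x)"
proof -
  have "emeasure (point_masses I w x) UNIV = 1"
    using assms by (simp add: emeasure_point_masses)
  then interpret prob_space "point_masses I w x"
    by (intro prob_spaceI) simp
  show ?thesis
    by unfold_locales simp_all
qed

text \<open>The empirical distribution of the \<open>n\<close>-th row; the value at \<open>n = 0\<close> is the zero measure.\<close>

definition empirical_distribution :: "(nat \<Rightarrow> nat \<Rightarrow> real) \<Rightarrow> nat \<Rightarrow> real measure" where
  "empirical_distribution p n = point_masses {1..n} (\<lambda>_. 1 / real n) (break_point p n)"

text \<open>\<open>q \<delta>\<^sub>0 + (1 - q) \<delta>\<^sub>1\<close>\<close>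

definition two_point_distribution :: "real \<Rightarrow> real measure" where
  "two_point_distribution q = point_masses {0, 1 :: nat} (\<lambda>i. if i = 0 then q else 1 - q) real"

lemma real_distribution_empirical: "n \<ge> 1 \<Longrightarrow> real_distribution (empirical_distribution p n)"
  unfolding empirical_distribution_def by (rule real_distribution_point_masses) auto

lemma real_distribution_two_point:
  "q \<in> {0..1} \<Longrightarrow> real_distribution (two_point_distribution q)"
  unfolding two_point_distribution_def by (rule real_distribution_point_masses) auto

definition iid_unit_interval :: "'a measure \<Rightarrow> ('i \<Rightarrow> 'a \<Rightarrow> real) \<Rightarrow> 'i set \<Rightarrow> bool" where
  "iid_unit_interval M X I \<longleftrightarrow>
     prob_space.indep_vars M (\<lambda>_. borel) X I \<and>
     (\<forall>i\<in>I. \<forall>j\<in>I. distr M borel (X i) = distr M borel (X j)) \<and>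
     (\<forall>i\<in>I. \<forall>\<omega>\<in>space M. X i \<omega> \<in> {0..1})"

end

theory Submission
  imports Defs
begin

text \<open>
  Reading the recursion backwards, \<open>a\<^bsub>n,k\<^esub>\<close> is the probability that a walk that starts at
  \<open>k\<close> at time \<open>n\<close>, steps down by one with probability \<open>p m j\<close> from a place \<open>1 \<le> j \<le> m\<close> at time
  \<open>m\<close> and stays otherwise, is at a positive place at time \<open>0\<close>. If the proportions average to
  \<open>q\<close>, the walk loses about \<open>q n\<close> on the way, so \<open>a\<^bsub>n,k\<^esub>\<close> is close to \<open>0\<close> for \<open>k\<close> well below \<open>q n\<close> and close to \<open>1\<close> for \<open>k\<close> well
  above it. A fraction \<open>q\<close> of the break points then accumulates at \<open>0\<close> and the rest at \<open>1\<close>; the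
  indices within \<open>\<epsilon> n\<close> of \<open>q n\<close> carry mass of order \<open>\<epsilon>\<close> only
  (\<open>weak_conv_if_far_deviation_tendsto_0\<close>).

  In the stratified case the closeness is quantified by Chernoff bounds, which are proved by
  induction along the recursion: at distance at least \<open>\<epsilon> n\<close> from \<open>q n\<close> the error is
  exponentially small in \<open>n\<close> (\<open>far_deviation_stratified_le_exp\<close>).

  The two random cases need no separate concentration argument. The proportions of a row are
  independent of the break points of the row before, so the expected break points satisfy the
  recursion with all proportions equal to \<open>q\<close> (\<open>expectation_A\<close>). The distance of a number in
  \<open>[0,1]\<close> to \<open>0\<close> or to \<open>1\<close> is affine, so the expected error is the error of this deterministic
  array. Away from \<open>q n\<close> it is summable over \<open>n\<close>, and thus the random error there tends to \<open>0\<close>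
  almost surely.
\<close>

section \<open>The break point recursion\<close>

lemma break_point_above: "n < k \<Longrightarrow> break_point p n k = 1"
  by (cases n) auto

lemma break_point_0 [simp]: "break_point p n 0 = 0"
  by (cases n) auto

text \<open>
  The boundary value \<open>1\<close> obeys the recursion as well, because both break points of the row before
  that enter it are then \<open>1\<close>.
\<close>

lemma break_point_step:
  assumes "1 \<le> k"
  shows "break_point p (Suc n) k =
           p (Suc n) k * break_point p n (k - 1) + (1 - p (Suc n) k) * break_point p n k"
  using assms by (cases "k > Suc n") (auto simp: break_point_above)

lemma break_point_cong:
  assumes "\<And>m j. \<lbrakk>1 \<le> j; j \<le> m; m \<le> n\<rbrakk> \<Longrightarrow> p m j = p' m j"
  shows "break_point p n k = break_point p' n k"
  using assms
proof (induction n arbitrary: k)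
  case (Suc n)
  then have "break_point p n j = break_point p' n j" for j
    by simp
  with Suc.prems show ?case
    by simp
qed simp

lemma break_point_in_unit_interval:
  assumes "\<And>m j. \<lbrakk>1 \<le> j; j \<le> m; m \<le> n\<rbrakk> \<Longrightarrow> p m j \<in> {0..1}"
  shows "break_point p n k \<in> {0..1}"
  using assms
proof (induction n arbitrary: k)
  case (Suc n)
  have IH: "break_point p n j \<in> {0..1}" for j
    using Suc by simp
  show ?case
  proof (cases "1 \<le> k \<and> k \<le> Suc n")
    case True
    then have p: "p (Suc n) k \<in> {0..1}"
      by (intro Suc.prems) auto
    have "p (Suc n) k * break_point p n (k - 1) + (1 - p (Suc n) k) * break_point p n k
            \<le> p (Suc n) k * 1 + (1 - p (Suc n) k) * 1"
      using p IH by (intro add_mono mult_left_mono) auto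
    moreover have "0 \<le> p (Suc n) k * break_point p n (k - 1) + (1 - p (Suc n) k) * break_point p n k"
      using p IH[of k] IH[of "k - 1"] by simp
    ultimately show ?thesis
      using True by simp
  qed auto
qed simp

lemma borel_measurable_break_point:
  assumes "\<And>m j. \<lbrakk>1 \<le> j; j \<le> m; m \<le> n\<rbrakk> \<Longrightarrow> (\<lambda>\<omega>. p \<omega> m j) \<in> borel_measurable N"
  shows "(\<lambda>\<omega>. break_point (p \<omega>) n k) \<in> borel_measurable N"
  using assms
proof (induction n arbitrary: k)
  case (Suc n)
  have IH: "(\<lambda>\<omega>. break_point (p \<omega>) n j) \<in> borel_measurable N" for j
    using Suc by simp
  show ?case
  proof (cases "1 \<le> k \<and> k \<le> Suc n")
    case True
    then have "(\<lambda>\<omega>. p \<omega> (Suc n) k) \<in> borel_measurable N"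
      by (intro Suc.prems) auto
    with IH True show ?thesis
      by (simp add: borel_measurable_add borel_measurable_times borel_measurable_diff)
  qed auto
qed simp

section \<open>Exponential concentration in the stratified case\<close>

text \<open>
  A bound on the moment generating function of a Bernoulli variable, which follows from
  \<open>1 + x \<le> exp x\<close> and \<open>exp s \<le> 1 + s + s\<^sup>2\<close>.
\<close>

lemma bernoulli_mgf_le:
  fixes p s :: real
  assumes p: "p \<in> {0..1}" and s: "\<bar>s\<bar> \<le> 1"
  shows "p * exp s + (1 - p) \<le> exp (p * s + s\<^sup>2)"
proof -
  have exp_le: "exp s \<le> 1 + s + s\<^sup>2"
  proof (cases "0 \<le> s")
    case True
    with s show ?thesis by (intro exp_bound) auto
  next
    case False
    \<comment> \<open>\<open>1 / exp u \<le> 1 - u + u\<^sup>2\<close> because \<open>(1 + u) * (1 - u + u\<^sup>2) = 1 + u\<^sup>3\<close>\<close>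
    define u where "u = - s"
    have u: "0 \<le> u" "u \<le> 1" using False s by (auto simp: u_def)
    have "1 \<le> (1 + u) * (1 - u + u\<^sup>2)"
      using u by (simp add: algebra_simps power2_eq_square)
    also have "\<dots> \<le> exp u * (1 - u + u\<^sup>2)"
      using u by (intro mult_right_mono exp_ge_add_one_self) (auto simp: add_nonneg_nonneg)
    finally have "inverse (exp u) \<le> 1 - u + u\<^sup>2"
      by (simp add: field_simps)
    then show ?thesis
      by (simp add: u_def exp_minus)
  qed
  have "p * exp s + (1 - p) = 1 + p * (exp s - 1)"
    by (simp add: algebra_simps)
  also have "\<dots> \<le> exp (p * (exp s - 1))"
    by (rule exp_ge_add_one_self)
  also have "p * (exp s - 1) \<le> p * (s + s\<^sup>2)"
    using p exp_le by (intro mult_left_mono) auto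
  also have "p * (s + s\<^sup>2) \<le> p * s + s\<^sup>2"
    using p by (simp add: algebra_simps mult_left_le_one_le)
  finally show ?thesis by simp
qed

text \<open>
  In the stratified case \<open>a\<^bsub>n,k\<^esub>\<close> is the probability that a sum of independent Bernoulli
  variables with parameters \<open>p 1, \<dots>, p n\<close> is less than \<open>k\<close>. The Chernoff bounds for its two tails
  need no such sum: both right-hand sides are supersolutions of the recursion that dominate the
  initial row.
\<close>

lemma break_point_le_exp:
  assumes p: "\<And>m. m \<ge> 1 \<Longrightarrow> p m \<in> {0..1}" and t: "0 \<le> t" "t \<le> 1"
  shows "break_point (\<lambda>n k. p n) n k \<le> exp (t * (real k - (\<Sum>i=1..n. p i)) + t\<^sup>2 * real n)"
proof (induction n arbitrary: k)
  case 0
  show ?case using t by simp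
next
  case (Suc n)
  define S where "S = (\<Sum>i=1..n. p i)"
  define B where "B = (\<lambda>k::nat. exp (t * (real k - S) + t\<^sup>2 * real n))"
  have pn: "p (Suc n) \<in> {0..1}" by (rule p) simp
  show ?case
  proof (cases "k = 0")
    case False
    then have k: "1 \<le> k" by simp
    have B_pred: "B (k - 1) = B k * exp (- t)"
      using k by (simp add: B_def of_nat_diff algebra_simps flip: exp_add)
    have "break_point (\<lambda>n k. p n) (Suc n) k \<le> p (Suc n) * B (k - 1) + (1 - p (Suc n)) * B k"
      unfolding break_point_step[OF k] B_def S_def
      using pn by (intro add_mono mult_left_mono Suc.IH) auto
    also have "\<dots> = B k * (p (Suc n) * exp (- t) + (1 - p (Suc n)))"
      unfolding B_pred by (simp add: algebra_simps)
    also have "\<dots> \<le> B k * exp (p (Suc n) * (- t) + (- t)\<^sup>2)"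
      using t by (intro mult_left_mono bernoulli_mgf_le pn) (auto simp: B_def)
    also have "\<dots> = exp (t * (real k - (\<Sum>i=1..Suc n. p i)) + t\<^sup>2 * real (Suc n))"
      by (simp add: B_def S_def algebra_simps flip: exp_add)
    finally show ?thesis .
  qed simp
qed

lemma one_minus_break_point_le_exp:
  assumes p: "\<And>m. m \<ge> 1 \<Longrightarrow> p m \<in> {0..1}" and t: "0 \<le> t" "t \<le> 1"
  shows "1 - break_point (\<lambda>n k. p n) n k \<le> exp (t * ((\<Sum>i=1..n. p i) - real k) + t\<^sup>2 * real n)"
proof (induction n arbitrary: k)
  case 0
  show ?case using t by simp
next
  case (Suc n)
  define S where "S = (\<Sum>i=1..n. p i)"
  define B where "B = (\<lambda>k::nat. exp (t * (S - real k) + t\<^sup>2 * real n))"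
  have pn: "p (Suc n) \<in> {0..1}" by (rule p) simp
  show ?case
  proof (cases "k = 0")
    case True
    have "0 \<le> (\<Sum>i=1..Suc n. p i)"
      using p by (intro sum_nonneg) auto
    then show ?thesis
      using True t by (auto simp del: sum.cl_ivl_Suc of_nat_Suc)
  next
    case False
    then have k: "1 \<le> k" by simp
    have B_pred: "B (k - 1) = B k * exp t"
      using k by (simp add: B_def of_nat_diff algebra_simps flip: exp_add)
    have "1 - break_point (\<lambda>n k. p n) (Suc n) k =
            p (Suc n) * (1 - break_point (\<lambda>n k. p n) n (k - 1))
            + (1 - p (Suc n)) * (1 - break_point (\<lambda>n k. p n) n k)"
      unfolding break_point_step[OF k] by (simp add: algebra_simps)
    also have "\<dots> \<le> p (Suc n) * B (k - 1) + (1 - p (Suc n)) * B k"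
      unfolding B_def S_def
      using pn by (intro add_mono mult_left_mono Suc.IH) auto
    also have "\<dots> = B k * (p (Suc n) * exp t + (1 - p (Suc n)))"
      unfolding B_pred by (simp add: algebra_simps)
    also have "\<dots> \<le> B k * exp (p (Suc n) * t + t\<^sup>2)"
      using t by (intro mult_left_mono bernoulli_mgf_le pn) (auto simp: B_def)
    also have "\<dots> = exp (t * ((\<Sum>i=1..Suc n. p i) - real k) + t\<^sup>2 * real (Suc n))"
      by (simp add: B_def S_def algebra_simps flip: exp_add)
    finally show ?thesis .
  qed
qed

section \<open>Deviation from a unit step\<close>

text \<open>
  For large \<open>n\<close> the row \<open>k \<mapsto> a\<^bsub>n,k\<^esub>\<close> should look like a unit step at \<open>k = q n\<close>.
\<close>

definition step_deviation :: "(nat \<Rightarrow> nat \<Rightarrow> real) \<Rightarrow> real \<Rightarrow> nat \<Rightarrow> nat \<Rightarrow> real" where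
  "step_deviation p q n k = \<bar>break_point p n k - of_bool (q * real n < real k)\<bar>"

text \<open>
  The step is smeared out over a range of about \<open>sqrt n\<close> indices, so only the contribution of the
  indices at distance more than \<open>\<epsilon> n\<close> from \<open>q n\<close> can decay fast.
\<close>

definition far_deviation :: "(nat \<Rightarrow> nat \<Rightarrow> real) \<Rightarrow> real \<Rightarrow> real \<Rightarrow> nat \<Rightarrow> real" where
  "far_deviation p q \<epsilon> n =
     (\<Sum>k | k \<in> {1..n} \<and> \<epsilon> * real n < \<bar>real k - q * real n\<bar>. step_deviation p q n k) / real n"

lemma step_deviation_nonneg: "0 \<le> step_deviation p q n k"
  by (simp add: step_deviation_def)

lemma far_deviation_nonneg: "0 \<le> far_deviation p q \<epsilon> n"
  by (auto simp: far_deviation_def intro!: divide_nonneg_nonneg sum_nonneg step_deviation_nonneg)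

lemma far_deviation_le:
  assumes "0 \<le> B"
    and B: "\<And>k. \<epsilon> * real n < \<bar>real k - q * real n\<bar> \<Longrightarrow> step_deviation p q n k \<le> B"
  shows "far_deviation p q \<epsilon> n \<le> B"
proof (cases "n = 0")
  case False
  let ?F = "{k. k \<in> {1..n} \<and> \<epsilon> * real n < \<bar>real k - q * real n\<bar>}"
  have "(\<Sum>k\<in>?F. step_deviation p q n k) \<le> (\<Sum>k\<in>?F. B)"
    by (intro sum_mono B) auto
  also have "\<dots> \<le> (\<Sum>k\<in>{1..n}. B)"
    using assms(1) by (intro sum_mono2) auto
  finally show ?thesis
    using False unfolding far_deviation_def by (simp add: field_simps)
qed (use assms in \<open>simp add: far_deviation_def\<close>)

lemma step_deviation_stratified_le_exp:
  assumes p: "\<And>m. m \<ge> 1 \<Longrightarrow> p m \<in> {0..1}" and t: "0 \<le> t" "t \<le> 1"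
  shows "step_deviation (\<lambda>n k. p n) q n k \<le>
           exp (t * (\<bar>(\<Sum>i=1..n. p i) - q * real n\<bar> - \<bar>real k - q * real n\<bar>) + t\<^sup>2 * real n)"
proof -
  define S where "S = (\<Sum>i=1..n. p i)"
  have a: "break_point (\<lambda>n k. p n) n k \<in> {0..1}"
    by (rule break_point_in_unit_interval) (use p in auto)
  show ?thesis
  proof (cases "q * real n < real k")
    case True
    then have "step_deviation (\<lambda>n k. p n) q n k = 1 - break_point (\<lambda>n k. p n) n k"
      using a by (simp add: step_deviation_def)
    also have "\<dots> \<le> exp (t * (S - real k) + t\<^sup>2 * real n)"
      unfolding S_def by (rule one_minus_break_point_le_exp[OF p t])
    also have "\<dots> \<le> exp (t * (\<bar>S - q * real n\<bar> - \<bar>real k - q * real n\<bar>) + t\<^sup>2 * real n)"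
      using True t by (auto intro!: mult_left_mono)
    finally show ?thesis by (simp add: S_def)
  next
    case False
    then have "step_deviation (\<lambda>n k. p n) q n k = break_point (\<lambda>n k. p n) n k"
      using a by (simp add: step_deviation_def)
    also have "\<dots> \<le> exp (t * (real k - S) + t\<^sup>2 * real n)"
      unfolding S_def by (rule break_point_le_exp[OF p t])
    also have "\<dots> \<le> exp (t * (\<bar>S - q * real n\<bar> - \<bar>real k - q * real n\<bar>) + t\<^sup>2 * real n)"
      using False t by (auto intro!: mult_left_mono)
    finally show ?thesis by (simp add: S_def)
  qed
qed

text \<open>
  With the exponent \<open>t = \<epsilon> / 4\<close>, the gain \<open>t \<epsilon> n\<close> from the distance to the step
  exceeds the two losses \<open>t (\<epsilon> / 4) n\<close> and \<open>t\<^sup>2 n\<close> together by \<open>\<epsilon>\<^sup>2 n / 8\<close>.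
\<close>

lemma far_deviation_stratified_le_exp:
  assumes p: "\<And>m. m \<ge> 1 \<Longrightarrow> p m \<in> {0..1}" and \<epsilon>: "0 < \<epsilon>" "\<epsilon> \<le> 1"
    and S: "\<bar>(\<Sum>i=1..n. p i) - q * real n\<bar> \<le> \<epsilon> / 4 * real n"
  shows "far_deviation (\<lambda>n k. p n) q \<epsilon> n \<le> exp (- (\<epsilon>\<^sup>2 / 8)) ^ n"
proof (rule far_deviation_le)
  fix k
  assume k: "\<epsilon> * real n < \<bar>real k - q * real n\<bar>"
  have "step_deviation (\<lambda>n k. p n) q n k \<le>
      exp (\<epsilon> / 4 * (\<bar>(\<Sum>i=1..n. p i) - q * real n\<bar> - \<bar>real k - q * real n\<bar>)
           + (\<epsilon> / 4)\<^sup>2 * real n)"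
    using \<epsilon> by (intro step_deviation_stratified_le_exp p) auto
  also have "\<dots> \<le> exp (\<epsilon> / 4 * (\<epsilon> / 4 * real n - \<epsilon> * real n) + (\<epsilon> / 4)\<^sup>2 * real n)"
  proof -
    have "\<bar>(\<Sum>i=1..n. p i) - q * real n\<bar> - \<bar>real k - q * real n\<bar>
            \<le> \<epsilon> / 4 * real n - \<epsilon> * real n"
      using S k by linarith
    then have "\<epsilon> / 4 * (\<bar>(\<Sum>i=1..n. p i) - q * real n\<bar> - \<bar>real k - q * real n\<bar>)
            \<le> \<epsilon> / 4 * (\<epsilon> / 4 * real n - \<epsilon> * real n)"
      using \<epsilon> by (intro mult_left_mono) auto
    then show ?thesis by (simp only: exp_le_cancel_iff add_le_cancel_right)
  qed
  also have "\<dots> = exp (real n * (- (\<epsilon>\<^sup>2 / 8)))"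
    by (simp add: power2_eq_square field_simps)
  also have "\<dots> = exp (- (\<epsilon>\<^sup>2 / 8)) ^ n"
    by (rule exp_of_nat_mult)
  finally show "step_deviation (\<lambda>n k. p n) q n k \<le> exp (- (\<epsilon>\<^sup>2 / 8)) ^ n" .
qed simp

section \<open>From deviations to weak convergence\<close>

lemma measure_point_masses:
  assumes "\<And>i. i \<in> I \<Longrightarrow> 0 \<le> w i" "B \<in> sets borel"
  shows "measure (point_masses I w x) B = (\<Sum>i\<in>I. w i * indicator B (x i))"
proof -
  have "emeasure (point_masses I w x) B = (\<Sum>i\<in>I. ennreal (w i * indicator B (x i)))"
    using assms by (simp add: emeasure_point_masses ennreal_mult ennreal_indicator)
  also have "\<dots> = ennreal (\<Sum>i\<in>I. w i * indicator B (x i))"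
    using assms by (intro sum_ennreal) auto
  finally show ?thesis
    using assms by (simp add: measure_def sum_nonneg)
qed

lemma cdf_empirical_distribution:
  "cdf (empirical_distribution p n) x = (\<Sum>k=1..n. of_bool (break_point p n k \<le> x)) / real n"
proof -
  have "cdf (empirical_distribution p n) x =
          (\<Sum>k=1..n. 1 / real n * indicator {..x} (break_point p n k))"
    unfolding cdf_def2 empirical_distribution_def by (rule measure_point_masses) auto
  also have "\<dots> = (\<Sum>k=1..n. of_bool (break_point p n k \<le> x) / real n)"
    by (intro sum.cong refl) (simp add: indicator_def)
  finally show ?thesis unfolding sum_divide_distrib .
qed

lemma measure_two_point:
  assumes "q \<in> {0..1}" "B \<in> sets borel"
  shows "measure (two_point_distribution q) B = q * indicator B 0 + (1 - q) * indicator B 1"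
proof -
  have "measure (two_point_distribution q) B =
          (\<Sum>i\<in>{0, 1::nat}. (if i = 0 then q else 1 - q) * indicator B (real i))"
    unfolding two_point_distribution_def using assms by (intro measure_point_masses) auto
  then show ?thesis
    by (simp del: sum_mult_indicator)
qed

lemma cdf_two_point:
  assumes "q \<in> {0..1}"
  shows "cdf (two_point_distribution q) x = q * of_bool (0 \<le> x) + (1 - q) * of_bool (1 \<le> x)"
  unfolding cdf_def2 using assms by (simp add: measure_two_point indicator_def)

lemma card_index_window_le:
  assumes "0 \<le> r"
  shows "real (card {k \<in> {1..n::nat}. \<bar>real k - c\<bar> \<le> r}) \<le> 2 * r + 1"
proof -
  let ?W = "{k \<in> {1..n}. \<bar>real k - c\<bar> \<le> r}"
  have "card ?W = card (int ` ?W)"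
    by (simp add: card_image)
  also have "int ` ?W \<subseteq> {\<lceil>c - r\<rceil>..\<lfloor>c + r\<rfloor>}"
    by (auto simp: le_floor_iff ceiling_le_iff abs_le_iff algebra_simps)
  then have "card (int ` ?W) \<le> card {\<lceil>c - r\<rceil>..\<lfloor>c + r\<rfloor>}"
    by (intro card_mono) auto
  also have "\<dots> = nat (\<lfloor>c + r\<rfloor> - \<lceil>c - r\<rceil> + 1)"
    by simp
  finally have "real (card ?W) \<le> real (nat (\<lfloor>c + r\<rfloor> - \<lceil>c - r\<rceil> + 1))"
    by simp
  also have "\<dots> \<le> 2 * r + 1"
    using assms by linarith
  finally show ?thesis .
qed

text \<open>The deviations are at most \<open>1\<close>, so the window around the step costs no more than its size.\<close>

lemma mean_step_deviation_le:
  assumes p: "\<And>m j. \<lbrakk>1 \<le> j; j \<le> m\<rbrakk> \<Longrightarrow> p m j \<in> {0..1}" and "0 \<le> \<epsilon>" "1 \<le> n"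
  shows "(\<Sum>k=1..n. step_deviation p q n k) / real n
           \<le> 2 * \<epsilon> + 1 / real n + far_deviation p q \<epsilon> n"
proof -
  let ?F = "{k. k \<in> {1..n} \<and> \<epsilon> * real n < \<bar>real k - q * real n\<bar>}"
  let ?W = "{k \<in> {1..n}. \<bar>real k - q * real n\<bar> \<le> \<epsilon> * real n}"
  have "{1..n} = ?W \<union> ?F" "?W \<inter> ?F = {}" by auto
  then have "(\<Sum>k=1..n. step_deviation p q n k) =
      (\<Sum>k\<in>?W. step_deviation p q n k) + (\<Sum>k\<in>?F. step_deviation p q n k)"
    by (metis (no_types, lifting) finite_Un finite_atLeastAtMost sum.union_disjoint)
  also have "(\<Sum>k\<in>?W. step_deviation p q n k) \<le> (\<Sum>k\<in>?W. 1)"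
  proof (intro sum_mono)
    fix k
    have "break_point p n k \<in> {0..1}"
      by (rule break_point_in_unit_interval) (use p in auto)
    then show "step_deviation p q n k \<le> 1"
      by (auto simp: step_deviation_def)
  qed
  also have "(\<Sum>k\<in>?W. 1) \<le> 2 * (\<epsilon> * real n) + 1"
    using card_index_window_le[of "\<epsilon> * real n" n "q * real n"] assms by simp
  finally have "(\<Sum>k=1..n. step_deviation p q n k)
      \<le> 2 * (\<epsilon> * real n) + 1 + (\<Sum>k\<in>?F. step_deviation p q n k)"
    by simp
  then have "(\<Sum>k=1..n. step_deviation p q n k) / real n
      \<le> (2 * (\<epsilon> * real n) + 1 + (\<Sum>k\<in>?F. step_deviation p q n k)) / real n"
    by (rule divide_right_mono) simp
  also have "\<dots> = 2 * \<epsilon> + 1 / real n + far_deviation p q \<epsilon> n"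
    using \<open>1 \<le> n\<close> by (simp add: far_deviation_def add_divide_distrib)
  finally show ?thesis .
qed

lemma mean_step_deviation_tendsto_0:
  assumes p: "\<And>m j. \<lbrakk>1 \<le> j; j \<le> m\<rbrakk> \<Longrightarrow> p m j \<in> {0..1}"
    and far: "\<And>i. (\<lambda>n. far_deviation p q (inverse (real (Suc i))) n) \<longlonglongrightarrow> 0"
  shows "(\<lambda>n. (\<Sum>k=1..n. step_deviation p q n k) / real n) \<longlonglongrightarrow> 0"
proof (rule LIMSEQ_I)
  fix e :: real
  assume "0 < e"
  then obtain i where i: "inverse (real (Suc i)) < e / 4"
    using reals_Archimedean[of "e / 4"] by auto
  have "eventually (\<lambda>n. far_deviation p q (inverse (real (Suc i))) n < e / 4) sequentially"
    using far[of i] \<open>0 < e\<close> by (intro order_tendstoD) auto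
  moreover have "eventually (\<lambda>n. 1 / real n < e / 4) sequentially"
    using lim_1_over_n \<open>0 < e\<close> by (intro order_tendstoD) auto
  ultimately have "eventually (\<lambda>n. \<bar>(\<Sum>k=1..n. step_deviation p q n k) / real n\<bar> < e) sequentially"
    using eventually_ge_at_top[of 1]
  proof eventually_elim
    case (elim n)
    have "0 \<le> (\<Sum>k=1..n. step_deviation p q n k) / real n"
      by (intro divide_nonneg_nonneg sum_nonneg step_deviation_nonneg) auto
    moreover have "(\<Sum>k=1..n. step_deviation p q n k) / real n
        \<le> 2 * inverse (real (Suc i)) + 1 / real n + far_deviation p q (inverse (real (Suc i))) n"
      by (rule mean_step_deviation_le[OF p]) (use elim in auto)
    ultimately show ?case
      using elim i by linarith
  qed
  then show "\<exists>N. \<forall>n\<ge>N. norm ((\<Sum>k=1..n. step_deviation p q n k) / real n - 0) < e"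
    by (simp add: eventually_sequentially)
qed

lemma fraction_of_indices_below_tendsto:
  assumes q: "q \<in> {0..1}"
  shows "(\<lambda>n. (\<Sum>k=1..n. of_bool (real k \<le> q * real n)) / real n) \<longlonglongrightarrow> q"
proof -
  have "(\<Sum>k=1..n. of_bool (real k \<le> q * real n)) = real (nat \<lfloor>q * real n\<rfloor>)" for n
  proof -
    have "q * real n \<le> real n"
      using q by (simp add: mult_left_le_one_le)
    have "{k \<in> {1..n}. real k \<le> q * real n} = {1..nat \<lfloor>q * real n\<rfloor>}"
    proof (intro set_eqI iffI)
      fix k assume "k \<in> {k \<in> {1..n}. real k \<le> q * real n}"
      then show "k \<in> {1..nat \<lfloor>q * real n\<rfloor>}"
        using le_nat_floor[of k "q * real n"] by auto
    next
      fix k assume k: "k \<in> {1..nat \<lfloor>q * real n\<rfloor>}"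
      then have "real k \<le> real (nat \<lfloor>q * real n\<rfloor>)"
        by simp
      also have "\<dots> \<le> q * real n"
        using q by (intro of_nat_floor) auto
      finally have "real k \<le> q * real n" .
      with \<open>q * real n \<le> real n\<close> k show "k \<in> {k \<in> {1..n}. real k \<le> q * real n}"
        by auto
    qed
    then show ?thesis
      by (simp add: sum.If_cases of_bool_def Int_def)
  qed
  moreover have "(\<lambda>n. real (nat \<lfloor>q * real n\<rfloor>) / real n) \<longlonglongrightarrow> q"
  proof (rule real_tendsto_sandwich)
    show "(\<lambda>n. q - 1 / real n) \<longlonglongrightarrow> q"
      using tendsto_diff[OF tendsto_const lim_1_over_n] by simp
    show "eventually (\<lambda>n. q - 1 / real n \<le> real (nat \<lfloor>q * real n\<rfloor>) / real n) sequentially"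
      using eventually_gt_at_top[of 0]
    proof eventually_elim
      case (elim n)
      have "(q * real n - 1) / real n \<le> real (nat \<lfloor>q * real n\<rfloor>) / real n"
        by (intro divide_right_mono) linarith+
      then show ?case using elim by (simp add: diff_divide_distrib)
    qed
    show "eventually (\<lambda>n. real (nat \<lfloor>q * real n\<rfloor>) / real n \<le> q) sequentially"
      using eventually_gt_at_top[of 0]
    proof eventually_elim
      case (elim n)
      have "real (nat \<lfloor>q * real n\<rfloor>) \<le> q * real n"
        using q by (intro of_nat_floor) auto
      then show ?case using elim by (simp add: field_simps)
    qed
  qed (rule tendsto_const)
  ultimately show ?thesis by simp
qed

text \<open>
  Fix a continuity point \<open>x\<close> of the limit with \<open>0 \<le> x < 1\<close>. Whenever \<open>a\<^bsub>n,k\<^esub>\<close> lies on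
  the other side of \<open>x\<close> than the step does, the deviation is at least \<open>min x (1 - x)\<close>. So up to a
  multiple of the mean deviation the distribution function at \<open>x\<close> is the fraction of indices below
  \<open>q n\<close>. The point \<open>x = 0\<close> is a continuity point only if \<open>q = 0\<close>, and then every index is above
  the step, where a break point at \<open>0\<close> has deviation \<open>1\<close>.
\<close>

lemma weak_conv_if_far_deviation_tendsto_0:
  assumes q: "q \<in> {0..1}"
    and p: "\<And>m j. \<lbrakk>1 \<le> j; j \<le> m\<rbrakk> \<Longrightarrow> p m j \<in> {0..1}"
    and far: "\<And>i. (\<lambda>n. far_deviation p q (inverse (real (Suc i))) n) \<longlonglongrightarrow> 0"
  shows "weak_conv_m (\<lambda>n. empirical_distribution p n) (two_point_distribution q)"
  unfolding weak_conv_m_def weak_conv_def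
proof (intro allI impI)
  fix x
  assume cont: "isCont (cdf (two_point_distribution q)) x"
  interpret real_distribution "two_point_distribution q"
    by (rule real_distribution_two_point[OF q])
  have a: "break_point p n k \<in> {0..1}" for n k
    by (rule break_point_in_unit_interval) (use p in auto)
  have jump: "q = 0" if "x = 0"
    using cont that q by (simp add: isCont_cdf measure_two_point)
  consider "x < 0" | "1 \<le> x" | "0 \<le> x" "x < 1" by linarith
  then show "(\<lambda>n. cdf (empirical_distribution p n) x) \<longlonglongrightarrow> cdf (two_point_distribution q) x"
  proof cases
    case 1
    then have "\<not> break_point p n k \<le> x" for n k
      using a[of n k] by auto
    with 1 q show ?thesis
      by (simp add: cdf_empirical_distribution cdf_two_point)
  next
    case 2
    then have "break_point p n k \<le> x" for n k
      using a[of n k] by auto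
    then have "cdf (empirical_distribution p n) x = 1" if "n > 0" for n
      using that by (simp add: cdf_empirical_distribution)
    then have "(\<lambda>n. cdf (empirical_distribution p n) x) \<longlonglongrightarrow> 1"
      by (intro tendsto_eventually eventually_mono[OF eventually_gt_at_top[of 0]]) auto
    with 2 q show ?thesis
      by (simp add: cdf_two_point)
  next
    case 3
    define C where "C = (if x = 0 then 1 else 1 / x + 1 / (1 - x))"
    have term_le: "\<bar>of_bool (break_point p n k \<le> x) - of_bool (real k \<le> q * real n)\<bar>
        \<le> C * step_deviation p q n k" if "k \<in> {1..n}" for n k
    proof (cases "x = 0")
      case True
      with jump[OF True] that a[of n k] show ?thesis
        by (auto simp: C_def step_deviation_def of_bool_def)
    next
      case False
      with 3 have x: "0 < x" "x < 1" by auto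
      have C: "1 \<le> C * y" if "x \<le> y \<or> 1 - x \<le> y" for y
      proof -
        have "0 \<le> y" using that x by auto
        then have "1 \<le> 1 / x * y \<or> 1 \<le> 1 / (1 - x) * y"
          using that x by (auto simp: field_simps)
        moreover have "0 \<le> 1 / x * y" "0 \<le> 1 / (1 - x) * y"
          using \<open>0 \<le> y\<close> x by auto
        ultimately show ?thesis
          using False by (auto simp: C_def distrib_right)
      qed
      have "0 \<le> C * step_deviation p q n k"
        using x False step_deviation_nonneg[of p q n k] by (simp add: C_def)
      moreover have "x \<le> step_deviation p q n k \<or> 1 - x \<le> step_deviation p q n k"
        if "(break_point p n k \<le> x) \<noteq> (real k \<le> q * real n)"
        using that by (auto simp: step_deviation_def)
      ultimately show ?thesis
        using C by (cases "(break_point p n k \<le> x) = (real k \<le> q * real n)") auto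
    qed
    have "(\<lambda>n. cdf (empirical_distribution p n) x
               - (\<Sum>k=1..n. of_bool (real k \<le> q * real n)) / real n) \<longlonglongrightarrow> 0"
    proof (rule Lim_null_comparison)
      show "eventually (\<lambda>n. norm (cdf (empirical_distribution p n) x
               - (\<Sum>k=1..n. of_bool (real k \<le> q * real n)) / real n)
          \<le> C * ((\<Sum>k=1..n. step_deviation p q n k) / real n)) sequentially"
      proof (intro always_eventually allI)
        fix n
        have "norm (cdf (empirical_distribution p n) x
               - (\<Sum>k=1..n. of_bool (real k \<le> q * real n)) / real n) =
            \<bar>\<Sum>k=1..n. of_bool (break_point p n k \<le> x) - of_bool (real k \<le> q * real n)\<bar> / real n"
          by (simp add: cdf_empirical_distribution sum_subtractf flip: diff_divide_distrib)
        also have "\<dots> \<le> (\<Sum>k=1..n. C * step_deviation p q n k) / real n"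
          by (intro divide_right_mono order_trans[OF sum_abs] sum_mono term_le) auto
        finally show "norm (cdf (empirical_distribution p n) x
               - (\<Sum>k=1..n. of_bool (real k \<le> q * real n)) / real n)
          \<le> C * ((\<Sum>k=1..n. step_deviation p q n k) / real n)"
          by (simp add: sum_distrib_left)
      qed
      show "(\<lambda>n. C * ((\<Sum>k=1..n. step_deviation p q n k) / real n)) \<longlonglongrightarrow> 0"
        by (intro tendsto_mult_right_zero mean_step_deviation_tendsto_0 p far)
    qed
    from tendsto_add[OF this fraction_of_indices_below_tendsto[OF q]] 3 q show ?thesis
      by (simp add: cdf_two_point)
  qed
qed

section \<open>The deterministic stratified case\<close>

theorem weak_conv_stratified:
  assumes p: "\<And>m. m \<ge> 1 \<Longrightarrow> p m \<in> {0..1}"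
    and avg: "(\<lambda>n. (\<Sum>k=1..n. p k) / real n) \<longlonglongrightarrow> q"
  shows "weak_conv_m (\<lambda>n. empirical_distribution (\<lambda>n k. p n) n) (two_point_distribution q)"
proof (rule weak_conv_if_far_deviation_tendsto_0)
  have "0 \<le> (\<Sum>k=1..n. p k) / real n" for n
    using p by (intro divide_nonneg_nonneg sum_nonneg) auto
  then have "0 \<le> q"
    by (intro LIMSEQ_le_const[OF avg]) auto
  have "(\<Sum>k=1..n. p k) / real n \<le> 1" for n
  proof -
    have "(\<Sum>k=1..n. p k) \<le> (\<Sum>k=1..n. 1)"
      using p by (intro sum_mono) auto
    then show ?thesis by (simp add: divide_le_eq)
  qed
  then have "q \<le> 1"
    by (intro LIMSEQ_le_const2[OF avg]) auto
  with \<open>0 \<le> q\<close> show "q \<in> {0..1}" by simp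
next
  fix i :: nat
  define \<epsilon> where "\<epsilon> = inverse (real (Suc i))"
  have \<epsilon>: "0 < \<epsilon>" "\<epsilon> \<le> 1"
    by (auto simp: \<epsilon>_def field_simps)
  have "eventually (\<lambda>n. dist ((\<Sum>k=1..n. p k) / real n) q < \<epsilon> / 4) sequentially"
    using avg \<epsilon> by (intro tendstoD) auto
  then have "eventually (\<lambda>n. norm (far_deviation (\<lambda>n k. p n) q \<epsilon> n) \<le> exp (- (\<epsilon>\<^sup>2 / 8)) ^ n) sequentially"
    using eventually_gt_at_top[of 0]
  proof eventually_elim
    case (elim n)
    have "\<bar>(\<Sum>k=1..n. p k) - q * real n\<bar> = \<bar>(\<Sum>k=1..n. p k) / real n - q\<bar> * real n"
      using elim by (simp add: abs_mult_pos field_simps)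
    also have "\<dots> \<le> \<epsilon> / 4 * real n"
      using elim by (intro mult_right_mono) (auto simp: dist_real_def)
    finally show ?case
      using far_deviation_stratified_le_exp[OF p \<epsilon>] far_deviation_nonneg by simp
  qed
  moreover have "(\<lambda>n. exp (- (\<epsilon>\<^sup>2 / 8)) ^ n) \<longlonglongrightarrow> 0"
    using \<epsilon> by (intro LIMSEQ_realpow_zero) auto
  ultimately show "(\<lambda>n. far_deviation (\<lambda>n k. p n) q (inverse (real (Suc i))) n) \<longlonglongrightarrow> 0"
    unfolding \<epsilon>_def[symmetric] by (rule Lim_null_comparison)
qed (use p in auto)

section \<open>Random splitting proportions\<close>

text \<open>
  By monotone convergence the sum of all \<open>f n\<close> has finite expectation, so it is finite almost
  surely.
\<close>

lemma AE_tendsto_0_if_summable_expectation: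
  fixes f :: "nat \<Rightarrow> 'a \<Rightarrow> real"
  assumes int: "\<And>n. integrable M (f n)" and nonneg: "\<And>n \<omega>. 0 \<le> f n \<omega>"
    and summable: "summable (\<lambda>n. integral\<^sup>L M (f n))"
  shows "AE \<omega> in M. (\<lambda>n. f n \<omega>) \<longlonglongrightarrow> 0"
proof -
  have [measurable]: "f n \<in> borel_measurable M" for n
    using int by auto
  have "(\<integral>\<^sup>+ \<omega>. (\<Sum>n. ennreal (f n \<omega>)) \<partial>M) = (\<Sum>n. \<integral>\<^sup>+ \<omega>. ennreal (f n \<omega>) \<partial>M)"
    by (rule nn_integral_suminf) simp
  also have "\<dots> = (\<Sum>n. ennreal (integral\<^sup>L M (f n)))"
    using int nonneg by (simp add: nn_integral_eq_integral)
  also have "\<dots> = ennreal (\<Sum>n. integral\<^sup>L M (f n))"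
    using nonneg summable by (intro suminf_ennreal2) auto
  finally have "(\<integral>\<^sup>+ \<omega>. (\<Sum>n. ennreal (f n \<omega>)) \<partial>M) \<noteq> \<infinity>"
    by simp
  then have "AE \<omega> in M. (\<Sum>n. ennreal (f n \<omega>)) \<noteq> \<infinity>"
    by (intro nn_integral_PInf_AE) auto
  then show ?thesis
  proof eventually_elim
    case (elim \<omega>)
    then have "summable (\<lambda>n. f n \<omega>)"
      using nonneg by (intro summable_suminf_not_top) auto
    then show ?case by (rule summable_LIMSEQ_zero)
  qed
qed

text \<open>
  Both random cases take the proportion at \<open>(n, k)\<close> from an independent family \<open>X\<close> at an index
  \<open>\<iota> n k\<close>, with \<open>\<iota> n k = n\<close> and \<open>\<iota> n k = (n, k)\<close>. Different rows
  use different indices, so the proportions of a row are independent of all earlier rows.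
\<close>

locale random_proportions = prob_space M
  for M :: "'a measure" and X :: "'i \<Rightarrow> 'a \<Rightarrow> real" and I :: "'i set" +
  fixes \<iota> :: "nat \<Rightarrow> nat \<Rightarrow> 'i" and q :: real
  assumes indep: "indep_vars (\<lambda>_. borel) X I"
    and unit_interval: "\<And>i \<omega>. \<lbrakk>i \<in> I; \<omega> \<in> space M\<rbrakk> \<Longrightarrow> X i \<omega> \<in> {0..1}"
    and mean: "\<And>i. i \<in> I \<Longrightarrow> expectation (X i) = q"
    and index: "\<And>n k. \<lbrakk>1 \<le> k; k \<le> n\<rbrakk> \<Longrightarrow> \<iota> n k \<in> I"
    and fresh: "\<And>m j n k. \<lbrakk>1 \<le> j; j \<le> m; m < n; 1 \<le> k; k \<le> n\<rbrakk> \<Longrightarrow> \<iota> m j \<noteq> \<iota> n k"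
begin

abbreviation A :: "nat \<Rightarrow> nat \<Rightarrow> 'a \<Rightarrow> real" where
  "A n k \<omega> \<equiv> break_point (\<lambda>n k. X (\<iota> n k) \<omega>) n k"

lemma measurable_X: "i \<in> I \<Longrightarrow> X i \<in> borel_measurable M"
  using indep unfolding indep_vars_def by auto

lemma measurable_A [measurable]: "A n k \<in> borel_measurable M"
  by (rule borel_measurable_break_point) (blast intro: measurable_X index)

lemma A_in_unit_interval: "\<omega> \<in> space M \<Longrightarrow> A n k \<omega> \<in> {0..1}"
  by (rule break_point_in_unit_interval) (blast intro: unit_interval index)

lemma integrable_X: "i \<in> I \<Longrightarrow> integrable M (X i)"
  by (rule integrable_const_bound[where B = 1]) (use unit_interval measurable_X in auto)

lemma integrable_A [simp]: "integrable M (A n k)"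
  by (rule integrable_const_bound[where B = 1]) (use A_in_unit_interval in auto)

lemma indep_X_A:
  assumes "1 \<le> k" "k \<le> Suc n"
  shows "indep_var borel (X (\<iota> (Suc n) k)) borel (A n j)"
proof -
  define i where "i = \<iota> (Suc n) k"
  define J where "J = {\<iota> m l | m l. 1 \<le> l \<and> l \<le> m \<and> m \<le> n}"
  have "indep_var (PiM {i} (\<lambda>_. borel)) (\<lambda>\<omega>. restrict (\<lambda>i. X i \<omega>) {i})
                  (PiM J (\<lambda>_. borel)) (\<lambda>\<omega>. restrict (\<lambda>i. X i \<omega>) J)"
  proof (rule indep_var_restrict[OF indep])
    show "{i} \<inter> J = {}"
      using fresh[of _ _ "Suc n" k] assms by (force simp: i_def J_def)
    show "{i} \<subseteq> I" "J \<subseteq> I"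
      using index assms by (auto simp: i_def J_def)
  qed
  then have "indep_var borel ((\<lambda>f. f i) \<circ> (\<lambda>\<omega>. restrict (\<lambda>i. X i \<omega>) {i}))
      borel ((\<lambda>f. break_point (\<lambda>m l. f (\<iota> m l)) n j) \<circ> (\<lambda>\<omega>. restrict (\<lambda>i. X i \<omega>) J))"
  proof (rule indep_var_compose)
    show "(\<lambda>f. f i) \<in> borel_measurable (PiM {i} (\<lambda>_. borel))"
      by simp
    show "(\<lambda>f. break_point (\<lambda>m l. f (\<iota> m l)) n j) \<in> borel_measurable (PiM J (\<lambda>_. borel))"
    proof (rule borel_measurable_break_point)
      fix m l
      assume "1 \<le> l" "l \<le> m" "m \<le> n"
      then have "\<iota> m l \<in> J" by (auto simp: J_def)
      then show "(\<lambda>f. f (\<iota> m l)) \<in> borel_measurable (PiM J (\<lambda>_. borel))"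
        by simp
    qed
  qed
  moreover have "(\<lambda>f. f i) \<circ> (\<lambda>\<omega>. restrict (\<lambda>i. X i \<omega>) {i}) = X i"
    by auto
  moreover have "(\<lambda>f. break_point (\<lambda>m l. f (\<iota> m l)) n j) \<circ> (\<lambda>\<omega>. restrict (\<lambda>i. X i \<omega>) J) = A n j"
    by (auto simp: J_def fun_eq_iff intro!: break_point_cong)
  ultimately show ?thesis
    by (simp add: i_def)
qed

text \<open>
  The proportions of row \<open>n + 1\<close> are independent of the break points of row \<open>n\<close>, so expectations
  pass through the recursion.
\<close>

lemma expectation_A: "expectation (A n k) = break_point (\<lambda>_ _. q) n k"
proof (induction n arbitrary: k)
  case 0
  show ?case by (simp add: prob_space)
next
  case (Suc n)
  show ?case
  proof (cases "1 \<le> k \<and> k \<le> Suc n")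
    case True
    define Y where "Y = X (\<iota> (Suc n) k)"
    have i: "\<iota> (Suc n) k \<in> I"
      using True by (intro index) auto
    have ind: "indep_var borel Y borel (A n j)" for j
      unfolding Y_def using True by (intro indep_X_A) auto
    have Y: "integrable M Y" "expectation Y = q"
      using i by (auto simp: Y_def integrable_X mean)
    have YA: "integrable M (\<lambda>\<omega>. Y \<omega> * A n j \<omega>)"
      "expectation (\<lambda>\<omega>. Y \<omega> * A n j \<omega>) = q * expectation (A n j)" for j
      using indep_var_integrable[OF ind Y(1)] indep_var_lebesgue_integral[OF ind Y(1)] Y(2) by auto
    have "A (Suc n) k = (\<lambda>\<omega>. Y \<omega> * A n (k - 1) \<omega> + (A n k \<omega> - Y \<omega> * A n k \<omega>))"
      using True by (auto simp: Y_def algebra_simps)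
    then have "expectation (A (Suc n) k) =
        q * expectation (A n (k - 1)) + (expectation (A n k) - q * expectation (A n k))"
      using YA by simp
    then show ?thesis
      using True by (simp add: Suc.IH algebra_simps)
  qed (auto simp: prob_space)
qed

text \<open>
  On \<open>[0,1]\<close> the distance to either value of the step is an affine function, so the expected
  deviation is the deviation of the expectation.
\<close>

lemma
  shows integrable_step_deviation:
      "integrable M (\<lambda>\<omega>. step_deviation (\<lambda>n k. X (\<iota> n k) \<omega>) q n k)" (is ?int)
    and expectation_step_deviation:
      "expectation (\<lambda>\<omega>. step_deviation (\<lambda>n k. X (\<iota> n k) \<omega>) q n k) =
         step_deviation (\<lambda>_ _. q) q n k" (is ?exp)
proof -
  define b :: real where "b = of_bool (q * real n < real k)"
  have affine: "\<bar>a - b\<bar> = b + (1 - 2 * b) * a" if "a \<in> {0..1}" for a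
    using that by (auto simp: b_def)
  have eq: "step_deviation (\<lambda>n k. X (\<iota> n k) \<omega>) q n k = b + (1 - 2 * b) * A n k \<omega>"
    if "\<omega> \<in> space M" for \<omega>
    unfolding step_deviation_def b_def[symmetric] by (rule affine[OF A_in_unit_interval[OF that]])
  show ?int
    by (subst Bochner_Integration.integrable_cong[OF refl eq]) auto
  have "AE \<omega> in M. A n k \<omega> \<in> {0..1}"
    using A_in_unit_interval by (intro AE_I2)
  then have "expectation (A n k) \<in> {0..1}"
    by (auto intro!: integral_ge_const integral_le_const)
  have "expectation (\<lambda>\<omega>. step_deviation (\<lambda>n k. X (\<iota> n k) \<omega>) q n k)
      = expectation (\<lambda>\<omega>. b + (1 - 2 * b) * A n k \<omega>)"
    by (intro Bochner_Integration.integral_cong refl eq)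
  also have "\<dots> = b + (1 - 2 * b) * expectation (A n k)"
    by (simp add: prob_space)
  also have "\<dots> = \<bar>expectation (A n k) - b\<bar>"
    by (rule affine[symmetric]) fact
  finally show ?exp
    by (simp add: expectation_A step_deviation_def b_def)
qed

lemma integrable_far_deviation:
  "integrable M (\<lambda>\<omega>. far_deviation (\<lambda>n k. X (\<iota> n k) \<omega>) q \<epsilon> n)"
  unfolding far_deviation_def
  by (intro integrable_divide_zero Bochner_Integration.integrable_sum integrable_step_deviation)

lemma expectation_far_deviation:
  "expectation (\<lambda>\<omega>. far_deviation (\<lambda>n k. X (\<iota> n k) \<omega>) q \<epsilon> n) =
     far_deviation (\<lambda>_ _. q) q \<epsilon> n"
  unfolding far_deviation_def integral_divide_zero
  by (subst Bochner_Integration.integral_sum)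
    (auto simp only: integrable_step_deviation expectation_step_deviation)

text \<open>
  The exceptional null set depends on \<open>\<epsilon>\<close>; the countably many \<open>\<epsilon> = 1 / (i + 1)\<close> suffice.
\<close>

theorem AE_weak_conv:
  "AE \<omega> in M. weak_conv_m (\<lambda>n. empirical_distribution (\<lambda>n k. X (\<iota> n k) \<omega>) n)
     (two_point_distribution q)"
proof -
  have q: "q \<in> {0..1}"
  proof -
    have i: "\<iota> 1 1 \<in> I" by (rule index) auto
    have "AE \<omega> in M. X (\<iota> 1 1) \<omega> \<in> {0..1}"
      using unit_interval[OF i] by (intro AE_I2)
    then have "expectation (X (\<iota> 1 1)) \<in> {0..1}"
      using integrable_X[OF i] by (auto intro!: integral_ge_const integral_le_const)
    then show ?thesis unfolding mean[OF i] .
  qed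
  have "AE \<omega> in M. (\<lambda>n. far_deviation (\<lambda>n k. X (\<iota> n k) \<omega>) q (inverse (real (Suc i))) n) \<longlonglongrightarrow> 0" for i
  proof (rule AE_tendsto_0_if_summable_expectation)
    define \<epsilon> where "\<epsilon> = inverse (real (Suc i))"
    have \<epsilon>: "0 < \<epsilon>" "\<epsilon> \<le> 1"
      by (auto simp: \<epsilon>_def field_simps)
    have "far_deviation (\<lambda>_ _. q) q \<epsilon> n \<le> exp (- (\<epsilon>\<^sup>2 / 8)) ^ n" for n
      using far_deviation_stratified_le_exp[of "\<lambda>_. q" \<epsilon> n q] q \<epsilon> by simp
    then have le: "norm (far_deviation (\<lambda>_ _. q) q \<epsilon> n) \<le> exp (- (\<epsilon>\<^sup>2 / 8)) ^ n" for n
      by (simp add: far_deviation_nonneg)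
    have "summable (\<lambda>n. exp (- (\<epsilon>\<^sup>2 / 8)) ^ n)"
      using \<epsilon> by (intro summable_geometric) auto
    then have "summable (\<lambda>n. far_deviation (\<lambda>_ _. q) q \<epsilon> n)"
      by (rule summable_comparison_test'[OF _ le])
    then show "summable (\<lambda>n. expectation
        (\<lambda>\<omega>. far_deviation (\<lambda>n k. X (\<iota> n k) \<omega>) q (inverse (real (Suc i))) n))"
      by (simp add: expectation_far_deviation \<epsilon>_def)
  qed (auto intro: integrable_far_deviation far_deviation_nonneg)
  then have "AE \<omega> in M. \<forall>i. (\<lambda>n. far_deviation (\<lambda>n k. X (\<iota> n k) \<omega>) q (inverse (real (Suc i))) n) \<longlonglongrightarrow> 0"
    unfolding AE_all_countable by (rule allI)
  with AE_space show ?thesis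
  proof eventually_elim
    case (elim \<omega>)
    then show ?case
      by (intro weak_conv_if_far_deviation_tendsto_0 q unit_interval index) auto
  qed
qed

end

lemma expectation_eq_if_iid:
  assumes "iid_unit_interval M X I" "prob_space M" "i \<in> I" "j \<in> I"
  shows "integral\<^sup>L M (X i) = integral\<^sup>L M (X j)"
proof -
  interpret prob_space M by fact
  have ind: "indep_vars (\<lambda>_. borel) X I" and eq: "distr M borel (X i) = distr M borel (X j)"
    using assms unfolding iid_unit_interval_def by blast+
  have [measurable]: "X i \<in> borel_measurable M" "X j \<in> borel_measurable M"
    using ind assms unfolding indep_vars_def by auto
  have "integral\<^sup>L M (X i) = integral\<^sup>L (distr M borel (X i)) (\<lambda>x. x)"
    by (rule integral_distr[symmetric]) auto
  also have "\<dots> = integral\<^sup>L M (X j)"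
    unfolding eq by (rule integral_distr) auto
  finally show ?thesis .
qed

lemma random_proportions_if_iid:
  assumes "prob_space M" "iid_unit_interval M X I" "i \<in> I"
    and "\<And>n k. \<lbrakk>1 \<le> k; k \<le> n\<rbrakk> \<Longrightarrow> \<iota> n k \<in> I"
    and "\<And>m j n k. \<lbrakk>1 \<le> j; j \<le> m; m < n; 1 \<le> k; k \<le> n\<rbrakk> \<Longrightarrow> \<iota> m j \<noteq> \<iota> n k"
  shows "random_proportions M X I \<iota> (integral\<^sup>L M (X i))"
proof -
  interpret prob_space M by fact
  show ?thesis
  proof
    show "expectation (X j) = expectation (X i)" if "j \<in> I" for j
      by (rule expectation_eq_if_iid[OF assms(2,1) that assms(3)])
    show "indep_vars (\<lambda>_. borel) X I" "\<And>i \<omega>. \<lbrakk>i \<in> I; \<omega> \<in> space M\<rbrakk> \<Longrightarrow> X i \<omega> \<in> {0..1}"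
      using assms(2) unfolding iid_unit_interval_def by blast+
  qed (fact assms)+
qed

theorem theorem3p2:
  shows
    "(\<forall>(p :: nat \<Rightarrow> real) (pbar :: real).
        (\<forall>n\<ge>1. p n \<in> {0..1}) \<longrightarrow>
        (\<lambda>n. (\<Sum>k=1..n. p k) / real n) \<longlonglongrightarrow> pbar \<longrightarrow>
        weak_conv_m (\<lambda>n. empirical_distribution (\<lambda>n k. p n) n) (two_point_distribution pbar))
     \<and>
     (\<forall>(M :: 'a measure) (P :: nat \<Rightarrow> 'a \<Rightarrow> real).
        prob_space M \<longrightarrow>
        iid_unit_interval M P {1..} \<longrightarrow>
        (AE \<omega> in M.
           weak_conv_m (\<lambda>n. empirical_distribution (\<lambda>n k. P n \<omega>) n)
             (two_point_distribution (prob_space.expectation M (P 1)))))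
     \<and>
     (\<forall>(M :: 'a measure) (P :: nat \<Rightarrow> nat \<Rightarrow> 'a \<Rightarrow> real).
        prob_space M \<longrightarrow>
        iid_unit_interval M (\<lambda>(n, k). P n k) {(n, k). 1 \<le> k \<and> k \<le> n} \<longrightarrow>
        (AE \<omega> in M.
           weak_conv_m (\<lambda>n. empirical_distribution (\<lambda>n k. P n k \<omega>) n)
             (two_point_distribution (prob_space.expectation M (P 1 1)))))"
proof (intro conjI allI impI)
  fix p :: "nat \<Rightarrow> real" and pbar
  assume "\<forall>n\<ge>1. p n \<in> {0..1}" "(\<lambda>n. (\<Sum>k=1..n. p k) / real n) \<longlonglongrightarrow> pbar"
  then show "weak_conv_m (\<lambda>n. empirical_distribution (\<lambda>n k. p n) n) (two_point_distribution pbar)"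
    by (intro weak_conv_stratified) auto
next
  fix M :: "'a measure" and P :: "nat \<Rightarrow> 'a \<Rightarrow> real"
  assume "prob_space M" "iid_unit_interval M P {1..}"
  then interpret random_proportions M P "{1..}" "\<lambda>n k. n" "integral\<^sup>L M (P 1)"
    by (rule random_proportions_if_iid) auto
  show "AE \<omega> in M. weak_conv_m (\<lambda>n. empirical_distribution (\<lambda>n k. P n \<omega>) n)
      (two_point_distribution (integral\<^sup>L M (P 1)))"
    by (rule AE_weak_conv)
next
  fix M :: "'a measure" and P :: "nat \<Rightarrow> nat \<Rightarrow> 'a \<Rightarrow> real"
  let ?X = "\<lambda>(n, k). P n k"
  assume "prob_space M" "iid_unit_interval M ?X {(n, k). 1 \<le> k \<and> k \<le> n}"
  then interpret random_proportions M ?X "{(n, k). 1 \<le> k \<and> k \<le> n}" Pair "integral\<^sup>L M (?X (1, 1))"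
    by (rule random_proportions_if_iid) auto
  show "AE \<omega> in M. weak_conv_m (\<lambda>n. empirical_distribution (\<lambda>n k. P n k \<omega>) n)
      (two_point_distribution (integral\<^sup>L M (P 1 1)))"
    using AE_weak_conv by simp
qed

end
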